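(* For every odd $n\ge 5$, the octopus of order $n$, namely $O_{(n-1)/2}$, is, up to isomorphism, the unique tree $T$ of order $n$ with $cp_5(T) = (n+3)/2$; and hence it is also the unique tree $T$ of order $n$ with $c_5(T) = (n+3)/2$.
   Context: All graphs are finite, simple and undirected; the order of a graph is its number of vertices. A coloring assigns a color to each vertex; it is proper if adjacent vertices receive different colors. A subgraph (not necessarily induced) is rainbow if all its vertices receive pairwise different colors. $P_5$ is the path on $5$ vertices. $c_5(G)$ is the maximum number of different colors used in a (not necessarily proper) coloring of the vertices of $G$ having no rainbow subgraph isomorphic to $P_5$; $cp_5(G)$ is the maximum number of different colors used in a proper coloring of the vertices of $G$ having no rainbow subgraph isomorphic to $P_5$ (such a coloring always exists for trees). The octopus $O_b$ is the tree obtained from the star with $b$ edges by subdividing every edge exactly once; it has $2b+1$ vertices. *)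

theory Defs
  imports Main
begin

record 'a ugraph =
  verts :: "'a set"
  edges :: "'a set set"

definition simple_graph :: "'a ugraph \<Rightarrow> bool" where
  "simple_graph G \<longleftrightarrow> finite (verts G) \<and> (\<forall>e\<in>edges G. e \<subseteq> verts G \<and> card e = 2)"

abbreviation order :: "'a ugraph \<Rightarrow> nat" where
  "order G \<equiv> card (verts G)"

definition adj :: "'a ugraph \<Rightarrow> 'a \<Rightarrow> 'a \<Rightarrow> bool" where
  "adj G u v \<longleftrightarrow> {u, v} \<in> edges G"

definition graph_iso :: "'a ugraph \<Rightarrow> 'b ugraph \<Rightarrow> bool" where
  "graph_iso G H \<longleftrightarrow> (\<exists>f. bij_betw f (verts G) (verts H) \<and>
     (\<forall>u\<in>verts G. \<forall>v\<in>verts G. adj G u v \<longleftrightarrow> adj H (f u) (f v)))"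

definition is_subgraph :: "'a ugraph \<Rightarrow> 'a ugraph \<Rightarrow> bool" where
  "is_subgraph H G \<longleftrightarrow> simple_graph H \<and> verts H \<subseteq> verts G \<and> edges H \<subseteq> edges G"

definition graph_connected :: "'a ugraph \<Rightarrow> bool" where
  "graph_connected G \<longleftrightarrow> verts G \<noteq> {} \<and> (\<forall>u\<in>verts G. \<forall>v\<in>verts G. (adj G)\<^sup>*\<^sup>* u v)"

text \<open>A cycle is given by the list of its vertices in cyclic order, without repeating the first
  one at the end.\<close>

definition is_cycle :: "'a ugraph \<Rightarrow> 'a list \<Rightarrow> bool" where
  "is_cycle G xs \<longleftrightarrow> 3 \<le> length xs \<and> distinct xs \<and> successively (adj G) xs \<and> adj G (last xs) (hd xs)"

definition is_tree :: "'a ugraph \<Rightarrow> bool" where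
  "is_tree G \<longleftrightarrow> simple_graph G \<and> graph_connected G \<and> (\<nexists>xs. is_cycle G xs)"

definition path_graph :: "nat \<Rightarrow> nat ugraph" where
  "path_graph n = \<lparr>verts = {..<n}, edges = {{i, Suc i} | i. Suc i < n}\<rparr>"

definition star :: "nat \<Rightarrow> nat ugraph" where
  "star b = \<lparr>verts = {..b}, edges = {{0, i} | i. 1 \<le> i \<and> i \<le> b}\<rparr>"

text \<open>The new vertex subdividing the edge \<open>e\<close> is \<open>Inr e\<close>.\<close>

definition subdivide_edges :: "'a ugraph \<Rightarrow> ('a + 'a set) ugraph" where
  "subdivide_edges G = \<lparr>verts = Inl ` verts G \<union> Inr ` edges G,
     edges = {{Inl v, Inr e} | v e. e \<in> edges G \<and> v \<in> e}\<rparr>"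

definition octopus :: "nat \<Rightarrow> (nat + nat set) ugraph" where
  "octopus b = subdivide_edges (star b)"

text \<open>Graphs being finite, natural numbers suffice as colors. The values of a coloring outside
  the vertex set are irrelevant.\<close>

definition proper_coloring :: "'a ugraph \<Rightarrow> ('a \<Rightarrow> nat) \<Rightarrow> bool" where
  "proper_coloring G c \<longleftrightarrow> (\<forall>u\<in>verts G. \<forall>v\<in>verts G. adj G u v \<longrightarrow> c u \<noteq> c v)"

definition rainbow :: "'a ugraph \<Rightarrow> ('a \<Rightarrow> nat) \<Rightarrow> bool" where
  "rainbow H c \<longleftrightarrow> inj_on c (verts H)"

definition no_rainbow_P5 :: "'a ugraph \<Rightarrow> ('a \<Rightarrow> nat) \<Rightarrow> bool" where
  "no_rainbow_P5 G c \<longleftrightarrow> (\<nexists>H. is_subgraph H G \<and> graph_iso H (path_graph 5) \<and> rainbow H c)"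

definition c5 :: "'a ugraph \<Rightarrow> nat" where
  "c5 G = Max {card (c ` verts G) | c. no_rainbow_P5 G c}"

text \<open>For a finite graph without a proper coloring free of rainbow copies of \<open>P\<^sub>5\<close> the maximum is
  over the empty set and \<open>cp5\<close> has no meaning; for trees such a coloring always exists
  (a proper coloring with two colors).\<close>

definition cp5 :: "'a ugraph \<Rightarrow> nat" where
  "cp5 G = Max {card (c ` verts G) | c. proper_coloring G c \<and> no_rainbow_P5 G c}"

end

theory Submission
  imports Defs
begin

text \<open>Let \<open>A\<close>, \<open>B\<close> be the bipartition classes of a tree of order \<open>2b + 1\<close>, with \<open>A\<close> the smaller one. A path
  on five vertices has at least two in each class, so coloring \<open>A\<close> with one color and \<open>B\<close>
  injectively avoids rainbow paths. This gives \<open>b + 3\<close> colors unless \<open>A\<close> has exactly \<open>b\<close> elements, and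
  even then if \<open>A\<close> contains a leaf, as this leaf can get a color of its own. Otherwise all vertices
  of \<open>A\<close> have degree 2, so the tree is the subdivision of a tree on \<open>B\<close>. If the latter is not a star,
  then \<open>A\<close> is colored injectively and \<open>B\<close> with three colors: one for the inner vertices, one for the
  leaves at a fixed inner vertex and one for the other leaves. In the octopus, two arms whose colors are
  distinct and different from that of the center must share a color, which bounds the number of
  colors by \<open>b + 2\<close>.\<close>

section \<open>Graphs and rainbow paths\<close>

lemma adj_sym: "adj G u v \<Longrightarrow> adj G v u"
  by (simp add: adj_def insert_commute)

lemma adj_verts:
  assumes "simple_graph G" "adj G u v"
  shows "u \<in> verts G" "v \<in> verts G" "u \<noteq> v"
  using assms by (fastforce simp: simple_graph_def adj_def)+

lemma connected_closed_set:
  assumes "graph_connected G" "x \<in> S" "x \<in> verts G"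
    and closed: "\<And>u v. u \<in> S \<Longrightarrow> adj G u v \<Longrightarrow> v \<in> S"
  shows "verts G \<subseteq> S"
proof
  fix y assume "y \<in> verts G"
  then have "(adj G)\<^sup>*\<^sup>* x y" using assms by (auto simp: graph_connected_def)
  then show "y \<in> S" by induction (use assms in auto)
qed

text \<open>Carrying 0, ..., 4 back along an isomorphism to \<open>path_graph 5\<close> lists any
  copy of the path as five consecutively adjacent vertices, the form in which colorings are checked
  below.\<close>

lemma no_rainbow_P5I:
  assumes nr: "\<And>x0 x1 x2 x3 x4. \<lbrakk>adj G x0 x1; adj G x1 x2; adj G x2 x3; adj G x3 x4;
      distinct [x0, x1, x2, x3, x4]\<rbrakk> \<Longrightarrow> \<not> distinct [c x0, c x1, c x2, c x3, c x4]"
  shows "no_rainbow_P5 G c"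
  unfolding no_rainbow_P5_def
proof (rule notI, elim exE conjE)
  fix H assume sub: "is_subgraph H G" and iso: "graph_iso H (path_graph 5)" and rb: "rainbow H c"
  obtain f where f: "bij_betw f (verts H) {..<5}"
    and fa: "\<And>u v. u \<in> verts H \<Longrightarrow> v \<in> verts H \<Longrightarrow> adj H u v \<longleftrightarrow> adj (path_graph 5) (f u) (f v)"
    using iso by (auto simp: graph_iso_def path_graph_def)
  define g where "g = inv_into (verts H) f"
  have g: "bij_betw g {..<5} (verts H)" unfolding g_def by (rule bij_betw_inv_into[OF f])
  have fg: "f (g i) = i" if "i < 5" for i
    unfolding g_def using bij_betw_inv_into_right[OF f] that by simp
  have gv: "g i \<in> verts H" if "i < 5" for i using g that by (auto simp: bij_betw_def)
  have ga: "adj G (g i) (g (Suc i))" if "Suc i < 5" for i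
  proof -
    have "adj (path_graph 5) i (Suc i)" using that by (auto simp: adj_def path_graph_def)
    then have "adj H (g i) (g (Suc i))" using fa[of "g i" "g (Suc i)"] gv fg that by simp
    then show ?thesis using sub by (auto simp: is_subgraph_def adj_def)
  qed
  have gi: "g i = g j \<longleftrightarrow> i = j" if "i < 5" "j < 5" for i j
    using g that by (auto simp: bij_betw_def inj_on_def)
  have ci: "c (g i) = c (g j) \<longleftrightarrow> i = j" if "i < 5" "j < 5" for i j
    using rb gv gi that unfolding rainbow_def inj_on_def by metis
  have "adj G (g 0) (g 1)" "adj G (g 1) (g 2)" "adj G (g 2) (g 3)" "adj G (g 3) (g 4)"
    using ga[of 0] ga[of 1] ga[of 2] ga[of 3] by (simp_all add: eval_nat_numeral)
  then have "\<not> distinct [c (g 0), c (g 1), c (g 2), c (g 3), c (g 4)]"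
    by (rule nr) (simp add: gi del: One_nat_def)
  then show False by (simp add: ci)
qed

lemma rainbow_path_not_no_rainbow_P5:
  assumes sg: "simple_graph G"
    and a: "adj G x0 x1" "adj G x1 x2" "adj G x2 x3" "adj G x3 x4"
    and d: "distinct [c x0, c x1, c x2, c x3, c x4]"
  shows "\<not> no_rainbow_P5 G c"
proof -
  define x where "x i = [x0, x1, x2, x3, x4] ! i" for i
  have five: "i < 5 \<longleftrightarrow> i = 0 \<or> i = 1 \<or> i = 2 \<or> i = 3 \<or> i = 4" for i :: nat by auto
  have "inj_on (nth (map c [x0, x1, x2, x3, x4])) {..<5}"
    using d by (intro inj_on_nth) auto
  moreover have "(c \<circ> x) i = map c [x0, x1, x2, x3, x4] ! i" if "i \<in> {..<5}" for i
    using that nth_map[of i "[x0, x1, x2, x3, x4]" c] by (simp add: x_def del: list.map)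
  ultimately have cx: "inj_on (c \<circ> x) {..<5}" using inj_on_cong[of "{..<5}"] by blast
  \<comment> \<open>Distinct colors force distinct vertices, so the chain spans a path.\<close>
  then have xi: "inj_on x {..<5}" by (rule inj_on_imageI2)
  have xa: "adj G (x i) (x (Suc i))" if "Suc i < 5" for i
  proof -
    have "i = 0 \<or> i = 1 \<or> i = 2 \<or> i = 3" using that by auto
    then show ?thesis using a by (auto simp: x_def eval_nat_numeral)
  qed
  define H where "H = \<lparr>verts = x ` {..<5}, edges = {{x i, x (Suc i)} | i. Suc i < 5}\<rparr>"
  have inj: "x i = x j \<longleftrightarrow> i = j" if "i < 5" "j < 5" for i j
    using xi that by (auto simp: inj_on_def)
  have "is_subgraph H G"
    unfolding is_subgraph_def simple_graph_def
  proof (intro conjI ballI)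
    show "finite (verts H)" by (simp add: H_def)
    show "e \<subseteq> verts H" if "e \<in> edges H" for e using that by (auto simp: H_def)
    show "card e = 2" if "e \<in> edges H" for e
    proof -
      from that obtain i where "e = {x i, x (Suc i)}" "Suc i < 5" by (auto simp: H_def)
      then show ?thesis using inj[of i "Suc i"] by simp
    qed
    show "verts H \<subseteq> verts G"
    proof -
      have "x i \<in> verts G" if "i < 5" for i
        using a adj_verts[OF sg] that by (auto simp: x_def five)
      then show ?thesis by (auto simp: H_def)
    qed
    show "edges H \<subseteq> edges G" using xa by (auto simp: H_def adj_def)
  qed
  moreover have "graph_iso H (path_graph 5)"
    unfolding graph_iso_def
  proof (intro exI[of _ "inv_into {..<5} x"] conjI ballI)
    show "bij_betw (inv_into {..<5} x) (verts H) (verts (path_graph 5))"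
      using xi by (simp add: H_def path_graph_def bij_betw_inv_into inj_on_imp_bij_betw)
    fix u v assume "u \<in> verts H" "v \<in> verts H"
    then obtain i j where ij: "i < 5" "j < 5" "u = x i" "v = x j" by (auto simp: H_def)
    have "adj H (x i) (x j) \<longleftrightarrow> adj (path_graph 5) i j"
      unfolding adj_def H_def path_graph_def using inj ij(1,2)
      by (auto simp: doubleton_eq_iff)
    then show "adj H u v \<longleftrightarrow> adj (path_graph 5) (inv_into {..<5} x u) (inv_into {..<5} x v)"
      using ij xi by (simp add: inv_into_f_f)
  qed
  moreover have "rainbow H c"
    using cx by (simp add: rainbow_def H_def inj_on_imageI)
  ultimately show ?thesis unfolding no_rainbow_P5_def by blast
qed

section \<open>Color counts as lower bounds\<close>

lemma finite_color_counts:
  assumes "simple_graph G"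
  shows "finite {card (c ` verts G) | c. P c}"
proof (rule finite_subset)
  show "{card (c ` verts G) | c. P c} \<subseteq> {..card (verts G)}"
    using assms by (auto simp: simple_graph_def card_image_le)
qed simp

lemma cp5_ge:
  assumes "simple_graph G" "proper_coloring G c" "no_rainbow_P5 G c"
  shows "card (c ` verts G) \<le> cp5 G"
  unfolding cp5_def by (rule Max_ge[OF finite_color_counts[OF assms(1)]]) (use assms in blast)

lemma c5_ge:
  assumes "simple_graph G" "no_rainbow_P5 G c"
  shows "card (c ` verts G) \<le> c5 G"
  unfolding c5_def by (rule Max_ge[OF finite_color_counts[OF assms(1)]]) (use assms in blast)

section \<open>Rooted trees\<close>

text \<open>\<open>p\<close> is the parent and \<open>d\<close> the depth. That every edge joins a
  vertex to its parent encodes acyclicity.\<close>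

definition rooted :: "'a ugraph \<Rightarrow> 'a \<Rightarrow> ('a \<Rightarrow> 'a) \<Rightarrow> ('a \<Rightarrow> nat) \<Rightarrow> bool" where
  "rooted G r p d \<longleftrightarrow> d r = 0 \<and>
     (\<forall>v\<in>verts G - {r}. p v \<in> verts G \<and> adj G v (p v) \<and> d v = Suc (d (p v))) \<and>
     (\<forall>u v. adj G u v \<longrightarrow> (u \<noteq> r \<and> v = p u) \<or> (v \<noteq> r \<and> u = p v))"

lemma rtranclp_distinct_path:
  assumes "R\<^sup>*\<^sup>* x y"
  shows "\<exists>xs. xs \<noteq> [] \<and> hd xs = x \<and> last xs = y \<and> distinct xs \<and> successively R xs"
  using assms
proof induction
  case base
  show ?case by (rule exI[of _ "[x]"]) simp
next
  case (step y z)
  then obtain xs where xs: "xs \<noteq> []" "hd xs = x" "last xs = y" "distinct xs" "successively R xs"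
    by blast
  show ?case
  proof (cases "z \<in> set xs")
    case True
    \<comment> \<open>The walk returns to \<open>z\<close>; cutting the list off after
      \<open>z\<close> keeps it a path.\<close>
    then obtain ys zs where yz: "xs = ys @ z # zs" by (meson split_list)
    then have "successively R (ys @ [z])" using xs(5)
      by (auto simp: successively_append_iff)
    then show ?thesis using xs yz
      by (intro exI[of _ "ys @ [z]"]) (auto simp: hd_append)
  next
    case False
    then show ?thesis using xs step.hyps(2)
      by (intro exI[of _ "xs @ [z]"]) (auto simp: successively_append_iff)
  qed
qed

text \<open>A path from \<open>x\<close> to \<open>y\<close> avoiding the edge between them would be
  closed to a cycle by that edge.\<close>

lemma tree_edge_bridge:
  assumes tree: "is_tree G" and xy: "adj G x y"
  shows "\<not> (\<lambda>u v. adj G u v \<and> {u, v} \<noteq> {x, y})\<^sup>*\<^sup>* x y"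
proof
  let ?R = "\<lambda>u v. adj G u v \<and> {u, v} \<noteq> {x, y}"
  assume "?R\<^sup>*\<^sup>* x y"
  from rtranclp_distinct_path[OF this] obtain xs
    where xs: "xs \<noteq> []" "hd xs = x" "last xs = y" "distinct xs" "successively ?R xs"
    by blast
  have "x \<noteq> y" using adj_verts(3)[OF _ xy] tree by (auto simp: is_tree_def)
  \<comment> \<open>With two vertices the path would be the excluded edge itself.\<close>
  have "3 \<le> length xs"
  proof (rule ccontr)
    assume "\<not> 3 \<le> length xs"
    then consider "length xs = 0" | "length xs = 1" | "length xs = 2" by linarith
    then show False
    proof cases
      case 3
      then obtain a b where "xs = [a, b]" by (auto simp: numeral_eq_Suc length_Suc_conv)
      then show False using xs by auto
    qed (use xs \<open>x \<noteq> y\<close> in \<open>auto simp: length_Suc_conv\<close>)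
  qed
  moreover have "successively (adj G) xs"
    using xs(5) by (rule successively_mono) auto
  ultimately have "is_cycle G xs"
    using xs adj_sym[OF xy] by (simp add: is_cycle_def)
  then show False using tree by (auto simp: is_tree_def)
qed

text \<open>Breadth-first search; an edge outside the resulting spanning tree would close a cycle.\<close>

lemma tree_rooted:
  assumes tree: "is_tree G" and r: "r \<in> verts G"
  shows "\<exists>p d. rooted G r p d"
proof -
  have sg: "simple_graph G" and con: "graph_connected G" using tree by (auto simp: is_tree_def)
  define d where "d v = (LEAST k. (adj G ^^ k) r v)" for v
  have reach: "\<exists>k. (adj G ^^ k) r v" if "v \<in> verts G" for v
    using con r that by (auto simp: graph_connected_def rtranclp_power)
  have d_path: "(adj G ^^ d v) r v" if "v \<in> verts G" for v
    unfolding d_def using reach[OF that] by (rule LeastI_ex)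
  have d_le: "d v \<le> k" if "(adj G ^^ k) r v" for v k
    unfolding d_def using that by (rule Least_le)
  have d0: "d r = 0" using d_le[of 0 r] by simp
  have "\<exists>w. w \<in> verts G \<and> adj G v w \<and> d v = Suc (d w)" if v: "v \<in> verts G - {r}" for v
  proof -
    have pv: "(adj G ^^ d v) r v" using d_path v by simp
    obtain m where m: "d v = Suc m" using pv v by (cases "d v") auto
    then obtain w where w: "(adj G ^^ m) r w" "adj G w v" using pv by auto
    have wv: "w \<in> verts G" using adj_verts[OF sg w(2)] by simp
    have "(adj G ^^ Suc (d w)) r v" using d_path[OF wv] w(2) by auto
    then have "d v \<le> Suc (d w)" by (rule d_le)
    moreover have "d w \<le> m" using w(1) by (rule d_le)
    ultimately show ?thesis using m wv adj_sym[OF w(2)] by auto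
  qed
  then obtain p where p: "\<And>v. v \<in> verts G - {r} \<Longrightarrow>
      p v \<in> verts G \<and> adj G v (p v) \<and> d v = Suc (d (p v))" by metis
  have edge: "(u \<noteq> r \<and> v = p u) \<or> (v \<noteq> r \<and> u = p v)" if uv: "adj G u v" for u v
  proof (rule ccontr)
    assume n: "\<not> ?thesis"
    \<comment> \<open>Parent edges all differ from \<open>{u, v}\<close>, so both ends climb to
      \<open>r\<close> and are joined without using their own edge.\<close>
    let ?R = "\<lambda>a b. adj G a b \<and> {a, b} \<noteq> {u, v}"
    have parent: "?R w (p w)" if "w \<in> verts G - {r}" for w
      using p[OF that] that n by (auto simp: doubleton_eq_iff)
    have up: "?R\<^sup>*\<^sup>* w r" if "w \<in> verts G" for w
      using that
    proof (induction "d w" arbitrary: w rule: less_induct)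
      case less
      show ?case
      proof (cases "w = r")
        case False
        then have "?R w (p w)" and "?R\<^sup>*\<^sup>* (p w) r"
          using parent[of w] less p[of w] by auto
        then show ?thesis by (rule converse_rtranclp_into_rtranclp)
      qed simp
    qed
    have "symp ?R" by (auto intro!: sympI dest: adj_sym simp: insert_commute)
    then have "symp ?R\<^sup>*\<^sup>*" by (rule symp_rtranclp)
    moreover have "?R\<^sup>*\<^sup>* v r" "?R\<^sup>*\<^sup>* u r" using up adj_verts[OF sg uv] by auto
    ultimately have "?R\<^sup>*\<^sup>* u v" by (meson rtranclp_trans sympD)
    then show False using tree_edge_bridge[OF tree uv] by blast
  qed
  show ?thesis unfolding rooted_def using d0 p edge by blast
qed

section \<open>Leaves and deepest vertices\<close>

definition leaf :: "'a ugraph \<Rightarrow> 'a \<Rightarrow> bool" where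
  "leaf G v \<longleftrightarrow> (\<forall>y z. adj G v y \<longrightarrow> adj G v z \<longrightarrow> y = z)"

lemma leafD: "leaf G v \<Longrightarrow> adj G v y \<Longrightarrow> adj G v z \<Longrightarrow> y = z"
  by (auto simp: leaf_def)

lemma rooted_depth_adj:
  assumes "simple_graph G" "rooted G r p d" "adj G u v"
  shows "d u = Suc (d v) \<or> d v = Suc (d u)"
  using assms adj_verts[OF assms(1,3)] unfolding rooted_def by blast

text \<open>A deepest vertex is not the parent of any neighbour, so its own parent is the only
  neighbour possible.\<close>

lemma deepest_leaf:
  assumes sg: "simple_graph G" and rt: "rooted G r p d"
    and max: "\<And>w. w \<in> verts G \<Longrightarrow> d w \<le> d v"
  shows "leaf G v"
proof -
  have "y = p v" if "adj G v y" for y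
  proof -
    have "d y \<le> d v" using max adj_verts[OF sg that] by simp
    then have "y \<noteq> r \<Longrightarrow> v \<noteq> p y" using rt adj_verts[OF sg that] by (fastforce simp: rooted_def)
    then show ?thesis using rt that unfolding rooted_def by blast
  qed
  then show ?thesis by (auto simp: leaf_def)
qed

lemma ex_deepest:
  assumes "simple_graph G" "verts G \<noteq> {}"
  shows "\<exists>v\<in>verts G. \<forall>w\<in>verts G. d w \<le> (d v :: nat)"
proof -
  have "finite (d ` verts G)" "d ` verts G \<noteq> {}" using assms by (auto simp: simple_graph_def)
  then have "Max (d ` verts G) \<in> d ` verts G" "\<forall>w\<in>verts G. d w \<le> Max (d ` verts G)"
    by (auto intro: Max_in)
  then show ?thesis by (metis imageE)
qed

section \<open>Bipartitions and colorings\<close>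

definition bipartition :: "'a ugraph \<Rightarrow> 'a set \<Rightarrow> 'a set \<Rightarrow> bool" where
  "bipartition G A B \<longleftrightarrow> A \<union> B = verts G \<and> A \<inter> B = {} \<and>
     (\<forall>u v. adj G u v \<longrightarrow> u \<in> A \<and> v \<in> B \<or> u \<in> B \<and> v \<in> A)"

lemma bipartition_adj:
  assumes "bipartition G A B" "adj G u v"
  shows "u \<in> A \<longleftrightarrow> v \<in> B" "u \<in> B \<longleftrightarrow> v \<in> A" "u \<in> A \<or> u \<in> B" "\<not> (u \<in> A \<and> u \<in> B)"
  using assms unfolding bipartition_def by blast+

lemma bipartition_swap: "bipartition G A B \<Longrightarrow> bipartition G B A"
  unfolding bipartition_def by blast

text \<open>Depth changes by one along each edge, so its parity splits the vertices.\<close>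

lemma tree_bipartition:
  assumes "is_tree G"
  shows "\<exists>A B. bipartition G A B"
proof -
  have sg: "simple_graph G" using assms by (simp add: is_tree_def)
  obtain r where "r \<in> verts G" using assms by (auto simp: is_tree_def graph_connected_def)
  then obtain p d where rt: "rooted G r p d" using tree_rooted[OF assms] by blast
  have "even (d u) \<longleftrightarrow> odd (d v)" if "adj G u v" for u v
    using rooted_depth_adj[OF sg rt that] by auto
  then have "bipartition G {v\<in>verts G. even (d v)} {v\<in>verts G. odd (d v)}"
    unfolding bipartition_def using adj_verts[OF sg] by blast
  then show ?thesis by blast
qed

text \<open>Here \<open>S\<close> is empty or a single leaf, which covers both uses at once. A leaf
  can only be an end of a path, and a path ending in \<open>A\<close> has two further vertices in
  \<open>A\<close>, so the leaf may have its own color.\<close>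

lemma coloring_constant_on_part:
  assumes sg: "simple_graph G" and bip: "bipartition G A B"
    and S: "S \<subseteq> A" "\<And>v w. v \<in> S \<Longrightarrow> w \<in> S \<Longrightarrow> v = w" "\<And>v. v \<in> S \<Longrightarrow> leaf G v"
    and ne: "A - S \<noteq> {}"
  shows "\<exists>c. proper_coloring G c \<and> no_rainbow_P5 G c \<and> card (c ` verts G) = Suc (card B + card S)"
proof -
  have fin: "finite (verts G)" using sg by (simp add: simple_graph_def)
  have AB: "A \<union> B = verts G" "A \<inter> B = {}" using bip by (auto simp: bipartition_def)
  obtain g :: "'a \<Rightarrow> nat" where g: "inj_on g (verts G)"
    using finite_imp_inj_to_nat_seg[OF fin] by blast
  \<comment> \<open>Color 0 is reserved for the constant part; \<open>Suc\<close> keeps the other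
    colors off it.\<close>
  define c where "c v = (if v \<in> A - S then 0 else Suc (g v))" for v
  have "proper_coloring G c"
    unfolding proper_coloring_def
  proof (intro ballI impI)
    fix u v assume uv: "u \<in> verts G" "v \<in> verts G" "adj G u v"
    then have "u \<noteq> v" using adj_verts[OF sg] by blast
    then show "c u \<noteq> c v"
      using bipartition_adj[OF bip uv(3)] inj_onD[OF g _ uv(1,2)] AB by (auto simp: c_def)
  qed
  moreover have "no_rainbow_P5 G c"
  proof (rule no_rainbow_P5I)
    fix x0 x1 x2 x3 x4
    assume a: "adj G x0 x1" "adj G x1 x2" "adj G x2 x3" "adj G x3 x4"
      and dis: "distinct [x0, x1, x2, x3, x4]"
    note b = bipartition_adj[OF bip a(1)] bipartition_adj[OF bip a(2)]
      bipartition_adj[OF bip a(3)] bipartition_adj[OF bip a(4)]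
    show "\<not> distinct [c x0, c x1, c x2, c x3, c x4]"
    proof (cases "x0 \<in> A")
      case True
      then have "x0 \<in> A" "x2 \<in> A" "x4 \<in> A" using b by auto
      \<comment> \<open>Of the three path vertices in \<open>A\<close> at most one is in
        \<open>S\<close>, so two share color 0.\<close>
      moreover have "x0 \<notin> S \<and> x2 \<notin> S \<or> x0 \<notin> S \<and> x4 \<notin> S \<or> x2 \<notin> S \<and> x4 \<notin> S"
        using S(2) dis by auto
      ultimately show ?thesis by (auto simp: c_def)
    next
      case False
      then have "x1 \<in> A" "x3 \<in> A" using b by auto
      \<comment> \<open>An inner vertex of the path has two distinct neighbours, so it is not a
        leaf.\<close>
      moreover have "x1 \<notin> S" using S(3) leafD adj_sym[OF a(1)] a(2) dis by fastforce
      moreover have "x3 \<notin> S" using S(3) leafD adj_sym[OF a(3)] a(4) dis by fastforce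
      ultimately show ?thesis by (auto simp: c_def)
    qed
  qed
  moreover have "card (c ` verts G) = Suc (card B + card S)"
  proof -
    have V: "verts G = (A - S) \<union> (B \<union> S)" and dj: "(A - S) \<inter> (B \<union> S) = {}"
      using AB S(1) by auto
    have "c ` (A - S) = {0}" using ne by (auto simp: c_def)
    moreover have cb: "c ` (B \<union> S) = Suc ` g ` (B \<union> S)"
      using dj by (auto simp: c_def image_def)
    ultimately have "c ` verts G = insert 0 (Suc ` g ` (B \<union> S))" by (simp add: V image_Un)
    moreover have "card (Suc ` g ` (B \<union> S)) = card (B \<union> S)"
      using inj_on_subset[OF g, of "B \<union> S"] V by (simp add: card_image)
    moreover have "card (B \<union> S) = card B + card S"
      using AB S(1) fin by (intro card_Un_disjoint) (auto intro: finite_subset)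
    moreover have "finite (B \<union> S)" using V fin by (metis finite_Un)
    ultimately show ?thesis by (simp add: card_insert_if)
  qed
  ultimately show ?thesis by blast
qed

text \<open>The graph is a subdivision of a graph on \<open>B\<close> with edge set \<open>A\<close>. In the latter, \<open>u\<close> is an inner
  vertex with an adjacent leaf \<open>l\<close>, and the leaf \<open>v\<close> is not adjacent to \<open>u\<close>.\<close>

lemma coloring_subdivision:
  assumes sg: "simple_graph G" and bip: "bipartition G A B"
    and two: "\<And>a. a \<in> A \<Longrightarrow> \<exists>y z. y \<noteq> z \<and> (\<forall>w. adj G a w \<longleftrightarrow> w = y \<or> w = z)"
    and u: "u \<in> B" "\<not> leaf G u"
    and l: "l \<in> B" "leaf G l" "adj G u a" "adj G a l"
    and v: "v \<in> B" "leaf G v" "\<And>a. adj G u a \<Longrightarrow> \<not> adj G a v"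
  shows "\<exists>c. proper_coloring G c \<and> no_rainbow_P5 G c \<and> card A + 3 \<le> card (c ` verts G)"
proof -
  have fin: "finite (verts G)" using sg by (simp add: simple_graph_def)
  have AB: "A \<union> B = verts G" "A \<inter> B = {}" using bip by (auto simp: bipartition_def)
  obtain g :: "'a \<Rightarrow> nat" where g: "inj_on g (verts G)"
    using finite_imp_inj_to_nat_seg[OF fin] by blast
  \<comment> \<open>In the subdivided graph, \<open>N\<close> consists of \<open>u\<close> and its
    neighbours. Its leaves get color 1, other leaves 2 and inner vertices 0; the shift by 3 keeps
    \<open>A\<close> off these colors.\<close>
  define N where "N = {w. \<exists>a. adj G u a \<and> adj G a w}"
  define c where "c w = (if w \<in> A then g w + 3 else if \<not> leaf G w then 0 else
      if w \<in> N then 1 else 2)" for w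
  have "proper_coloring G c"
    unfolding proper_coloring_def
  proof (intro ballI impI)
    fix x y assume xy: "adj G x y"
    then show "c x \<noteq> c y"
      using bipartition_adj[OF bip xy] bipartition_adj[OF bip adj_sym[OF xy]]
      by (auto simp: c_def)
  qed
  moreover have "no_rainbow_P5 G c"
  proof (rule no_rainbow_P5I)
    fix x0 x1 x2 x3 x4
    assume a: "adj G x0 x1" "adj G x1 x2" "adj G x2 x3" "adj G x3 x4"
      and dis: "distinct [x0, x1, x2, x3, x4]"
    note b = bipartition_adj[OF bip a(1)] bipartition_adj[OF bip a(2)]
      bipartition_adj[OF bip a(3)] bipartition_adj[OF bip a(4)]
    have nl: "\<not> leaf G x1" "\<not> leaf G x2" "\<not> leaf G x3"
      using leafD adj_sym[OF a(1)] a(2) adj_sym[OF a(2)] a(3) adj_sym[OF a(3)] a(4) dis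
      by fastforce+
    show "\<not> distinct [c x0, c x1, c x2, c x3, c x4]"
    proof (cases "x0 \<in> A")
      case True
      then have "x1 \<notin> A" "x3 \<notin> A" using b by auto
      then show ?thesis using nl by (auto simp: c_def)
    next
      case False
      then have x: "x1 \<in> A" "x3 \<in> A" "x0 \<notin> A" "x2 \<notin> A" "x4 \<notin> A" using b by auto
      \<comment> \<open>An end of the path that is not a leaf shares color 0 with \<open>x2\<close>,
        so both ends may be taken as leaves. If one is in \<open>N\<close>, its middle vertex is
        adjacent only to it and to \<open>x2\<close>, so \<open>x2\<close> is the non-leaf
        \<open>u\<close>; then the other end is in \<open>N\<close> too.\<close>
      have N: "e' \<in> N" if "e \<in> N" "leaf G e" "adj G e m" "m \<in> A" "adj G m x2" "e \<noteq> x2"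
        "adj G x2 m'" "adj G m' e'" for e m m' e'
      proof -
        from that(1) obtain k where k: "adj G u k" "adj G k e" by (auto simp: N_def)
        then have km: "k = m" using leafD[OF that(2)] adj_sym that(3) by metis
        from two[OF that(4)] obtain y z where "\<And>w. adj G m w \<longleftrightarrow> w = y \<or> w = z" by blast
        then have "u = x2 \<or> u = e"
          using adj_sym[OF k(1)] adj_sym[OF that(3)] that(5,6) km by metis
        then have "u = x2" using that(2) u(2) by blast
        then show ?thesis using that(7,8) by (auto simp: N_def)
      qed
      have "x0 \<in> N \<longleftrightarrow> x4 \<in> N" if "leaf G x0" "leaf G x4"
        using N[OF _ that(1) a(1) x(1) a(2) _ a(3) a(4)]
          N[OF _ that(2) adj_sym[OF a(4)] x(2) adj_sym[OF a(3)] _ adj_sym[OF a(2)] adj_sym[OF a(1)]]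
          dis by auto
      then show ?thesis using x nl by (auto simp: c_def)
    qed
  qed
  moreover have "card A + 3 \<le> card (c ` verts G)"
  proof -
    have fA: "finite A" using AB fin by (metis finite_Un)
    have "card ((\<lambda>w. g w + 3) ` A) = card A"
    proof (rule card_image, rule inj_onI)
      fix x y assume "x \<in> A" "y \<in> A" "g x + 3 = g y + 3"
      then show "x = y" using inj_onD[OF g] AB by auto
    qed
    then have "card A + 3 = card ((\<lambda>w. g w + 3) ` A \<union> {0, 1, 2})"
      using fA by (subst card_Un_disjoint) auto
    also have "\<dots> \<le> card (c ` verts G)"
    proof (rule card_mono)
      \<comment> \<open>The three vertices \<open>u\<close>, \<open>l\<close> and \<open>v\<close>
        show that all three colors of \<open>B\<close> occur.\<close>
      have "c u = 0" "c l = 1" "c v = 2" using u l v AB by (auto simp: c_def N_def)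
      then have "0 \<in> c ` verts G" "1 \<in> c ` verts G" "2 \<in> c ` verts G"
        using u(1) l(1) v(1) AB by (metis UnCI imageI)+
      moreover have "(\<lambda>w. g w + 3) ` A \<subseteq> c ` verts G"
        using AB by (auto simp: c_def image_iff intro!: bexI)
      ultimately show "(\<lambda>w. g w + 3) ` A \<union> {0, 1, 2} \<subseteq> c ` verts G" by blast
    qed (use fin in simp)
    finally show ?thesis .
  qed
  ultimately show ?thesis by blast
qed

section \<open>The octopus\<close>

text \<open>The center is \<open>Inl 0\<close>; arm \<open>i\<close> has the middle vertex
  \<open>Inr {0, i}\<close> and the tip \<open>Inl i\<close>.\<close>

lemma octopus_adj:
  "adj (octopus b) (Inl v) (Inr e) \<longleftrightarrow> (\<exists>i. 1 \<le> i \<and> i \<le> b \<and> e = {0, i} \<and> (v = 0 \<or> v = i))"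
  "adj (octopus b) (Inr e) (Inl v) \<longleftrightarrow> (\<exists>i. 1 \<le> i \<and> i \<le> b \<and> e = {0, i} \<and> (v = 0 \<or> v = i))"
  "\<not> adj (octopus b) (Inl v) (Inl w)"
  "\<not> adj (octopus b) (Inr e) (Inr e')"
  by (auto simp: adj_def octopus_def subdivide_edges_def star_def doubleton_eq_iff)

lemma octopus_verts:
  "verts (octopus b) = Inl ` {..b} \<union> (\<lambda>i. Inr {0, i}) ` {1..b}"
  by (auto simp: octopus_def subdivide_edges_def star_def image_iff)

lemma simple_octopus: "simple_graph (octopus b)"
  unfolding simple_graph_def
proof (intro conjI ballI)
  show "finite (verts (octopus b))" by (simp add: octopus_verts)
  fix e assume "e \<in> edges (octopus b)"
  then show "e \<subseteq> verts (octopus b)" "card e = 2"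
    by (auto simp: octopus_def subdivide_edges_def star_def)
qed

lemma order_octopus: "order (octopus b) = 2 * b + 1"
proof -
  have "inj_on (\<lambda>i::nat. Inr {0, i} :: nat + nat set) {1..b}"
    by (rule inj_onI) (auto simp: doubleton_eq_iff)
  then show ?thesis unfolding octopus_verts
    by (subst card_Un_disjoint) (auto simp: card_image)
qed

lemma bipartition_octopus:
  "bipartition (octopus b) ((\<lambda>i. Inr {0, i}) ` {1..b}) (Inl ` {..b})"
proof -
  have "u \<in> (\<lambda>i. Inr {0, i}) ` {1..b} \<and> v \<in> Inl ` {..b} \<or> u \<in> Inl ` {..b} \<and> v \<in> (\<lambda>i. Inr {0, i}) ` {1..b}"
    if "adj (octopus b) u v" for u v
    using adj_verts[OF simple_octopus that] that
    by (cases u; cases v) (auto simp: octopus_adj octopus_verts)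
  then show ?thesis unfolding bipartition_def octopus_verts by blast
qed

lemma connected_octopus: "graph_connected (octopus b)"
proof -
  let ?R = "(adj (octopus b))\<^sup>*\<^sup>*"
  have "symp (adj (octopus b))" by (auto intro: sympI adj_sym)
  then have sym: "symp ?R" by (rule symp_rtranclp)
  have "?R (Inl 0) v" if "v \<in> verts (octopus b)" for v
  proof -
    have mid: "?R (Inl 0) (Inr {0, i})" if "i \<in> {1..b}" for i
      using that by (intro r_into_rtranclp) (auto simp: octopus_adj)
    have tip: "?R (Inl 0) (Inl i)" if "i \<in> {1..b}" for i
      by (rule rtranclp.rtrancl_into_rtrancl[OF mid[OF that]]) (use that in \<open>auto simp: octopus_adj\<close>)
    show ?thesis
    proof (cases v)
      case (Inl i)
      then show ?thesis using tip[of i] that by (cases "i = 0") (auto simp: octopus_verts)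
    next
      case (Inr e)
      then show ?thesis using mid that by (auto simp: octopus_verts)
    qed
  qed
  moreover have "verts (octopus b) \<noteq> {}" by (auto simp: octopus_verts)
  ultimately show ?thesis unfolding graph_connected_def using sym
    by (meson rtranclp_trans sympD)
qed

section \<open>Acyclicity of the octopus\<close>

lemma cycle_two_neighbours:
  assumes cyc: "is_cycle G xs" and x: "x \<in> set xs"
  shows "\<exists>y\<in>set xs. \<exists>z\<in>set xs. y \<noteq> z \<and> adj G x y \<and> adj G x z"
proof -
  have len: "3 \<le> length xs" and dis: "distinct xs" and suc: "successively (adj G) xs"
    and close: "adj G (last xs) (hd xs)" using cyc by (auto simp: is_cycle_def)
  have ne: "xs \<noteq> []" using len by auto
  have step: "adj G (xs ! i) (xs ! Suc i)" if "Suc i < length xs" for i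
    using suc that by (simp add: successively_conv_nth)
  have nb: "xs ! i \<noteq> xs ! j" if "i < length xs" "j < length xs" "i \<noteq> j" for i j
    using dis that by (simp add: nth_eq_iff_index_eq)
  obtain k where k: "k < length xs" "x = xs ! k" using x by (auto simp: in_set_conv_nth)
  define n where "n = length xs"
  \<comment> \<open>Cyclic predecessor and successor of position \<open>k\<close>, with wrap-around;
    they differ because a cycle has at least three vertices.\<close>
  define i where "i = (if k = 0 then n - 1 else k - 1)"
  define j where "j = (if Suc k = n then 0 else Suc k)"
  have ij: "i < n" "j < n" "i \<noteq> j" using k(1) len by (auto simp: i_def j_def n_def)
  have "adj G (xs ! i) (xs ! k)"
    using close step[of "k - 1"] k(1) ne by (auto simp: i_def n_def last_conv_nth hd_conv_nth)
  moreover have "adj G (xs ! k) (xs ! j)"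
  proof (cases "Suc k = n")
    case True
    then have "length xs - 1 = k" by (simp add: n_def)
    then show ?thesis using close ne True by (simp add: j_def last_conv_nth hd_conv_nth)
  next
    case False
    then show ?thesis using step[of k] k(1) by (simp add: j_def n_def)
  qed
  ultimately show ?thesis using nb[of i j] ij k(2) adj_sym unfolding n_def by (metis nth_mem)
qed

text \<open>A vertex on a cycle has two neighbours on it. This excludes the tips, then the middle
  vertices, which are left with only the center as neighbour.\<close>

lemma tree_octopus: "is_tree (octopus b)"
  unfolding is_tree_def
proof (intro conjI notI simple_octopus connected_octopus)
  assume "\<exists>xs. is_cycle (octopus b) xs"
  then obtain xs where cyc: "is_cycle (octopus b) xs" by blast
  have tip: "Inl i \<notin> set xs" if "i \<noteq> 0" for i
  proof
    assume "Inl i \<in> set xs"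
    from cycle_two_neighbours[OF cyc this] obtain y z where
      yz: "y \<noteq> z" "adj (octopus b) (Inl i) y" "adj (octopus b) (Inl i) z" by blast
    then show False using that by (cases y; cases z) (auto simp: octopus_adj)
  qed
  have mid: "Inr e \<notin> set xs" for e
  proof
    assume "Inr e \<in> set xs"
    moreover have "y = Inl 0" if "y \<in> set xs" "adj (octopus b) (Inr e) y" for y
      using that(2) tip that(1) by (cases y rule: sum.exhaust) (auto simp: octopus_adj)
    ultimately show False using cycle_two_neighbours[OF cyc] by metis
  qed
  have "x = Inl 0" if "x \<in> set xs" for x
    using that tip mid by (metis sum.exhaust)
  then have "set xs \<subseteq> {Inl 0}" by blast
  then have "card (set xs) \<le> 1" using card_mono[of "{Inl 0}" "set xs"] by simp
  then show False using cyc by (simp add: is_cycle_def distinct_card)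
qed

text \<open>Colors on arms attached to a center of color \<open>z\<close>. An arm with two colors that occur on no
  other arm leaves at most one color different from \<open>z\<close> to each of the others.\<close>

lemma card_arm_colors:
  fixes f g :: "'i \<Rightarrow> 'c"
  assumes "finite I"
    and "\<And>i j. i \<in> I \<Longrightarrow> j \<in> I \<Longrightarrow> i \<noteq> j \<Longrightarrow> \<not> distinct [f i, g i, z, g j, f j]"
  shows "card (insert z (f ` I \<union> g ` I)) \<le> card I + 2"
proof -
  \<comment> \<open>An arm that by itself repeats a color or meets \<open>z\<close> contributes at
    most one new color.\<close>
  have one: "card (insert z (f ` I \<union> g ` I)) \<le> card I + 1"
    if "finite I" "\<And>i. i \<in> I \<Longrightarrow> \<not> distinct [f i, g i, z]" for I
    using that
  proof (induction I)
    case (insert i I)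
    let ?S = "insert z (f ` I \<union> g ` I)"
    have "\<not> distinct [f i, g i, z]" using insert.prems by simp
    then have "\<exists>x. insert (f i) (insert (g i) ?S) = insert x ?S" by auto
    then obtain x where "insert (f i) (insert (g i) ?S) = insert x ?S" by blast
    moreover have "insert z (f ` insert i I \<union> g ` insert i I) = insert (f i) (insert (g i) ?S)"
      by auto
    moreover have "card (insert x ?S) \<le> Suc (card ?S)" by (rule card_insert_le_m1) simp_all
    ultimately show ?case using insert by simp
  qed simp
  show ?thesis
    using assms
  proof (induction I)
    case (insert i I)
    let ?S = "insert z (f ` I \<union> g ` I)"
    have S: "insert z (f ` insert i I \<union> g ` insert i I) = insert (f i) (insert (g i) ?S)"
      by auto
    show ?case
    proof (cases "f i \<notin> ?S \<and> g i \<notin> ?S \<and> f i \<noteq> g i")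
      case True
      \<comment> \<open>The repetition on arms \<open>i\<close> and \<open>j\<close> cannot involve
        the colors of arm \<open>i\<close>, so it lies among \<open>z\<close> and the colors of arm
        \<open>j\<close>.\<close>
      have "\<not> distinct [f j, g j, z]" if "j \<in> I" for j
      proof -
        have "f j \<in> ?S" "g j \<in> ?S" "i \<noteq> j" using that insert.hyps by auto
        then show ?thesis using True insert.prems[of i j] that by auto
      qed
      then have "card ?S \<le> card I + 1" by (rule one[OF insert.hyps(1)])
      moreover have "card (insert (f i) (insert (g i) ?S)) \<le> card ?S + 2"
        using insert.hyps by (simp add: card_insert_if)
      ultimately show ?thesis unfolding S using insert.hyps by simp
    next
      case False
      have "card ?S \<le> card I + 2" using insert.IH insert.prems by blast
      moreover have "card (insert (f i) (insert (g i) ?S)) \<le> card ?S + 1"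
        using insert.hyps False by (auto simp: card_insert_if)
      ultimately show ?thesis unfolding S using insert.hyps by simp
    qed
  qed simp
qed

section \<open>Values of \<open>cp5\<close> and \<open>c5\<close> on the octopus\<close>

lemma octopus_colors_le:
  assumes "no_rainbow_P5 (octopus b) c"
  shows "card (c ` verts (octopus b)) \<le> b + 2"
proof -
  let ?f = "\<lambda>i. c (Inl i)" and ?g = "\<lambda>i. c (Inr {0, i})"
  \<comment> \<open>Two arms joined at the center form a path on five vertices; for
    \<open>i = j\<close> the colors repeat trivially.\<close>
  have "\<not> distinct [?f i, ?g i, c (Inl 0), ?g j, ?f j]" if "i \<in> {1..b}" "j \<in> {1..b}" for i j
    using rainbow_path_not_no_rainbow_P5[OF simple_octopus,
        of b "Inl i" "Inr {0, i}" "Inl 0" "Inr {0, j}" "Inl j" c] that assms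
    by (force simp: octopus_adj)
  then have "card (insert (c (Inl 0)) (?f ` {1..b} \<union> ?g ` {1..b})) \<le> b + 2"
    using card_arm_colors[of "{1..b}" ?f ?g "c (Inl 0)"] by simp
  moreover have "{..b} = insert 0 {1..b}" by auto
  then have "c ` verts (octopus b) = insert (c (Inl 0)) (?f ` {1..b} \<union> ?g ` {1..b})"
    unfolding octopus_verts by (simp add: image_Un image_image)
  ultimately show ?thesis by simp
qed

lemma octopus_cp5_c5:
  assumes "1 \<le> b"
  shows "cp5 (octopus b) = b + 2" "c5 (octopus b) = b + 2"
proof -
  let ?V = "verts (octopus b)"
  \<comment> \<open>The middle vertices share one color; the center and the \<open>b\<close> tips
    get distinct ones, which makes \<open>b + 2\<close> colors. Being proper, the coloring serves
    both parameters.\<close>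
  obtain c where c: "proper_coloring (octopus b) c" "no_rainbow_P5 (octopus b) c"
    "card (c ` ?V) = Suc (card (Inl ` {..b} :: (nat + nat set) set) + card ({} :: (nat + nat set) set))"
    using coloring_constant_on_part[OF simple_octopus bipartition_octopus, of "{}"] assms by auto
  then have card: "card (c ` ?V) = b + 2" by (simp add: card_image)
  have "cp5 (octopus b) \<le> b + 2" unfolding cp5_def
    by (rule Max.boundedI[OF finite_color_counts[OF simple_octopus]])
      (use c octopus_colors_le in blast)+
  moreover have "c5 (octopus b) \<le> b + 2" unfolding c5_def
    by (rule Max.boundedI[OF finite_color_counts[OF simple_octopus]])
      (use c octopus_colors_le in blast)+
  ultimately show "cp5 (octopus b) = b + 2" "c5 (octopus b) = b + 2"
    using cp5_ge[OF simple_octopus c(1,2)] c5_ge[OF simple_octopus c(2)] card by auto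
qed

text \<open>With \<open>u\<close> as center, the second neighbour of \<open>a\<close> in
  \<open>A\<close> becomes the tip of the arm through \<open>a\<close>. Equal cardinalities make
  this a bijection onto \<open>B - {u}\<close>.\<close>

lemma octopus_iso:
  assumes sg: "simple_graph G" and bip: "bipartition G A B"
    and card: "card A = b" "card B = Suc b" and u: "u \<in> B"
    and nb: "\<And>a. a \<in> A \<Longrightarrow> \<exists>w. w \<noteq> u \<and> (\<forall>x. adj G a x \<longleftrightarrow> x = u \<or> x = w)"
    and cov: "\<And>w. w \<in> B - {u} \<Longrightarrow> \<exists>a. adj G w a"
  shows "graph_iso G (octopus b)"
proof -
  have fin: "finite (verts G)" using sg by (simp add: simple_graph_def)
  have AB: "A \<union> B = verts G" "A \<inter> B = {}" using bip by (auto simp: bipartition_def)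
  have fAB: "finite A" "finite B" using AB fin by (metis finite_Un)+
  obtain q where q: "\<And>a. a \<in> A \<Longrightarrow> q a \<noteq> u \<and> (\<forall>x. adj G a x \<longleftrightarrow> x = u \<or> x = q a)"
    using nb by metis
  have "q ` A = B - {u}"
  proof
    show "q ` A \<subseteq> B - {u}" using q bipartition_adj(1)[OF bip] by blast
    show "B - {u} \<subseteq> q ` A"
    proof
      fix w assume w: "w \<in> B - {u}"
      then obtain a where a: "adj G w a" using cov by blast
      then have "a \<in> A" "w = q a" using bipartition_adj(2)[OF bip a] w q adj_sym[OF a] by blast+
      then show "w \<in> q ` A" by blast
    qed
  qed
  moreover have "card (B - {u}) = card A" using card u by simp
  ultimately have q_inj: "inj_on q A" using fAB by (metis eq_card_imp_inj_on)
  have qA: "q ` A = B - {u}" by fact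
  obtain h where h: "bij_betw h A {1..b}"
    using finite_same_card_bij[OF fAB(1), of "{1..b}"] card by auto
  \<comment> \<open>The numbering \<open>h\<close> of \<open>A\<close> numbers the arms; a tip takes
    the number of the middle vertex that \<open>q\<close> sends to it.\<close>
  define f where "f v = (if v \<in> A then Inr {0, h v} else if v = u then Inl 0
    else Inl (h (inv_into A q v)))" for v
  have uA: "u \<notin> A" and qnA: "a \<in> A \<Longrightarrow> q a \<notin> A" for a using u AB qA by auto
  have fA: "f a = Inr {0, h a}" if "a \<in> A" for a using that by (simp add: f_def)
  have fu: "f u = Inl 0" using uA by (simp add: f_def)
  have fq: "f (q a) = Inl (h a)" if "a \<in> A" for a
    using that q[OF that] qnA[OF that] q_inj by (simp add: f_def inv_into_f_f)
  have hA: "1 \<le> h a \<and> h a \<le> b" if "a \<in> A" for a using h that by (auto simp: bij_betw_def)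
  have h_inj: "h a = h a' \<longleftrightarrow> a = a'" if "a \<in> A" "a' \<in> A" for a a'
    using h that by (auto simp: bij_betw_def inj_on_def)
  have V: "verts G = A \<union> insert u (q ` A)" using AB u qA by auto
  have imf: "f ` verts G = verts (octopus b)"
  proof -
    have "h ` A = {1..b}" using h by (simp add: bij_betw_def)
    have "f ` A = (\<lambda>i. Inr {0, i}) ` h ` A" using fA by (simp add: image_image)
    moreover have "f ` q ` A = Inl ` h ` A" using fq by (simp add: image_image)
    moreover have "{..b} = insert 0 {1..b}" by auto
    ultimately show ?thesis
      unfolding V octopus_verts by (simp add: image_Un fu \<open>h ` A = {1..b}\<close> Un_commute)
  qed
  have "card (verts G) = 2 * b + 1"
    using card AB fAB card_Un_disjoint[of A B] by simp
  then have "inj_on f (verts G)"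
    using imf order_octopus[of b] fin by (intro eq_card_imp_inj_on) simp_all
  then have bij: "bij_betw f (verts G) (verts (octopus b))" using imf by (simp add: bij_betw_def)
  have adjA: "adj G a x \<longleftrightarrow> adj (octopus b) (f a) (f x)" if a: "a \<in> A" and x: "x \<in> verts G" for a x
  proof -
    have q_iff: "q a = q a' \<longleftrightarrow> a = a'" if "a' \<in> A" for a' using q_inj a that by (auto simp: inj_on_def)
    consider "x \<in> A" | "x = u" | a' where "a' \<in> A" "x = q a'" using x V by blast
    then show ?thesis
    proof cases
      case 1
      then show ?thesis using q[OF a] qnA[OF a] uA a by (auto simp: fA octopus_adj)
    next
      case 2
      then show ?thesis using q[OF a] hA[OF a] a by (auto simp: fA fu octopus_adj)
    next
      case 3
      have "adj G a x \<longleftrightarrow> a = a'" using q[OF a] q[OF 3(1)] q_iff[OF 3(1)] 3(2) by metis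
      moreover have "adj (octopus b) (f a) (f x) \<longleftrightarrow> a = a'"
        using hA[OF a] hA[OF 3(1)] h_inj[OF a 3(1)] 3 a
        by (auto simp: fA fq octopus_adj doubleton_eq_iff)
      ultimately show ?thesis by simp
    qed
  qed
  have "adj G x y \<longleftrightarrow> adj (octopus b) (f x) (f y)" if xy: "x \<in> verts G" "y \<in> verts G" for x y
  proof -
    \<comment> \<open>Pairs meeting \<open>A\<close> are settled by \<open>adjA\<close>; pairs
      inside \<open>B\<close> are non-adjacent in both graphs.\<close>
    consider "x \<in> A" | "y \<in> A" | "x \<in> B - A" "y \<in> B - A" using xy AB by blast
    then show ?thesis
    proof cases
      case 2
      then show ?thesis using adjA[OF 2 xy(1)] adj_sym by metis
    next
      case 3
      then have "\<not> adj G x y" using bipartition_adj(2)[OF bip] by blast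
      moreover have "\<exists>i. f x = Inl i" "\<exists>j. f y = Inl j" using 3 by (auto simp: f_def)
      ultimately show ?thesis using octopus_adj(3) by metis
    qed (use adjA xy in blast)
  qed
  then show ?thesis unfolding graph_iso_def using bij by blast
qed

section \<open>Trees other than the octopus\<close>

lemma rooted_bipartition_parity:
  assumes sg: "simple_graph G" and bip: "bipartition G A B" and rt: "rooted G r p d" "r \<in> B"
    and v: "v \<in> verts G"
  shows "v \<in> B \<longleftrightarrow> even (d v)"
  using v
proof (induction "d v" arbitrary: v rule: less_induct)
  case less
  show ?case
  proof (cases "v = r")
    case True
    then show ?thesis using rt by (simp add: rooted_def)
  next
    case False
    then have p: "p v \<in> verts G" "adj G v (p v)" "d v = Suc (d (p v))"
      using rt less.prems by (auto simp: rooted_def)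
    then show ?thesis using less.hyps[of "p v"] bipartition_adj[OF bip p(2)] by auto
  qed
qed

text \<open>Every vertex of \<open>A\<close> has a child, and there are as many non-root vertices in \<open>B\<close> as vertices
  in \<open>A\<close>.\<close>

lemma part_without_leaves_two_neighbours:
  assumes tree: "is_tree G" and bip: "bipartition G A B"
    and card: "card B = Suc (card A)" and nl: "\<And>a. a \<in> A \<Longrightarrow> \<not> leaf G a"
    and a: "a \<in> A"
  shows "\<exists>y z. y \<noteq> z \<and> (\<forall>w. adj G a w \<longleftrightarrow> w = y \<or> w = z)"
proof -
  have sg: "simple_graph G" using tree by (simp add: is_tree_def)
  then have fin: "finite (verts G)" by (simp add: simple_graph_def)
  have AB: "A \<union> B = verts G" "A \<inter> B = {}" using bip by (auto simp: bipartition_def)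
  \<comment> \<open>A root in \<open>B\<close> gives every vertex of \<open>A\<close> a
    parent.\<close>
  obtain r where r: "r \<in> B" using card by (cases "B = {}") auto
  then have rV: "r \<in> verts G" using AB by blast
  obtain p d where rt: "rooted G r p d" using tree_rooted[OF tree rV] by blast
  have pv: "p v \<in> verts G" "adj G v (p v)" "d v = Suc (d (p v))" if "v \<in> verts G" "v \<noteq> r" for v
    using rt that by (auto simp: rooted_def)
  have edge: "u \<noteq> r \<and> v = p u \<or> v \<noteq> r \<and> u = p v" if "adj G u v" for u v
    using rt that by (auto simp: rooted_def)
  have child: "\<exists>v. v \<in> B - {r} \<and> p v = x" if x: "x \<in> A" for x
  proof -
    obtain y where "adj G x y" "y \<noteq> p x" using nl[OF x] by (auto simp: leaf_def)
    then show ?thesis using edge[of x y] bipartition_adj(1)[OF bip] x by blast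
  qed
  have "p ` (B - {r}) = A"
  proof
    show "p ` (B - {r}) \<subseteq> A" using pv(2) AB bipartition_adj(2)[OF bip] by blast
    show "A \<subseteq> p ` (B - {r})" using child by blast
  qed
  moreover have "card (B - {r}) = card A" using card r by simp
  moreover have "finite (B - {r})" using AB fin by (metis finite_Diff finite_Un)
  \<comment> \<open>A surjection between finite sets of equal size: each vertex of \<open>A\<close>
    has exactly one child.\<close>
  ultimately have inj: "inj_on p (B - {r})" by (intro eq_card_imp_inj_on) simp_all
  obtain z where z: "z \<in> B - {r}" "p z = a" using child[OF a] by blast
  have aV: "a \<in> verts G" "a \<noteq> r" and zV: "z \<in> verts G" "z \<noteq> r" using a r z AB by auto
  have "adj G a w \<longleftrightarrow> w = p a \<or> w = z" for w
  proof
    assume w: "adj G a w"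
    then have "w \<in> B" using bipartition_adj(1)[OF bip w] a by blast
    then show "w = p a \<or> w = z" using edge[OF w] inj_onD[OF inj] z by blast
  next
    assume "w = p a \<or> w = z"
    then show "adj G a w" using pv(2)[OF aV] adj_sym[OF pv(2)[OF zV]] z(2) by blast
  qed
  moreover have "p a \<noteq> z"
  proof
    assume "p a = z"
    then have "d a = Suc (d z)" "d z = Suc (d a)"
      using pv(3)[OF aV] pv(3)[OF zV] z(2) by simp_all
    then show False by simp
  qed
  ultimately show ?thesis by blast
qed

text \<open>Finds the vertices for \<open>coloring_subdivision\<close>: a deepest leaf
  \<open>l\<close>, the vertex \<open>u\<close> across its only neighbour, and a leaf
  \<open>v\<close> farthest from \<open>u\<close>. If all of \<open>A\<close> is adjacent to
  \<open>u\<close>, the tree is an octopus.\<close>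

lemma non_octopus_coloring_two_neighbours:
  assumes tree: "is_tree G" and bip: "bipartition G A B"
    and card: "card A = b" "card B = Suc b" and b: "2 \<le> b"
    and two: "\<And>a. a \<in> A \<Longrightarrow> \<exists>y z. y \<noteq> z \<and> (\<forall>w. adj G a w \<longleftrightarrow> w = y \<or> w = z)"
    and not_iso: "\<not> graph_iso G (octopus b)"
  shows "\<exists>c. proper_coloring G c \<and> no_rainbow_P5 G c \<and> b + 3 \<le> card (c ` verts G)"
proof -
  have sg: "simple_graph G" and con: "graph_connected G" using tree by (auto simp: is_tree_def)
  have fin: "finite (verts G)" using sg by (simp add: simple_graph_def)
  have AB: "A \<union> B = verts G" "A \<inter> B = {}" using bip by (auto simp: bipartition_def)
  have ord: "card (verts G) = 2 * b + 1"
  proof -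
    have "finite A" "finite B" using AB fin by (metis finite_Un)+
    then show ?thesis using card AB card_Un_disjoint[of A B] by simp
  qed
  have nlA: "\<not> leaf G a" if "a \<in> A" for a using two[OF that] by (auto simp: leaf_def)
  \<comment> \<open>Rules out degenerate cases, the order being at least 5.\<close>
  have small: "card (verts G) \<le> 3" if "verts G \<subseteq> {x, y, z}" for x y z
    using card_mono[OF _ that] by (simp add: card_insert_if split: if_splits)
  obtain r where r: "r \<in> B" using card by (cases "B = {}") auto
  then have rV: "r \<in> verts G" using AB by blast
  obtain p d where rt: "rooted G r p d" using tree_rooted[OF tree rV] by blast
  have "verts G \<noteq> {}" using rV by blast
  from ex_deepest[OF sg this] obtain l where l: "l \<in> verts G" "\<And>w. w \<in> verts G \<Longrightarrow> d w \<le> d l"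
    by blast
  have lf: "leaf G l" by (rule deepest_leaf[OF sg rt l(2)])
  then have lB: "l \<in> B" using nlA l(1) AB by blast
  have "l \<noteq> r"
  proof
    assume "l = r"
    then have d0: "d w = 0" if "w \<in> verts G" for w using l(2)[OF that] rt by (simp add: rooted_def)
    have "w = r" if "w \<in> verts G" for w
    proof (rule ccontr)
      assume "w \<noteq> r"
      then have "d w = Suc (d (p w))" using rt that unfolding rooted_def by blast
      then show False using d0[OF that] by simp
    qed
    then have "verts G \<subseteq> {r, r, r}" by blast
    then show False using small[of r r r] ord b by simp
  qed
  then have la: "adj G l (p l)" using rt l(1) by (simp add: rooted_def)
  define a where "a = p l"
  have aA: "a \<in> A" using bipartition_adj(2)[OF bip la] lB by (simp add: a_def)
  have al: "adj G a l" using adj_sym[OF la] by (simp add: a_def)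
  obtain u where u: "u \<noteq> l" "\<And>w. adj G a w \<longleftrightarrow> w = u \<or> w = l" using two[OF aA] al by metis
  then have au: "adj G a u" by blast
  have uB: "u \<in> B" using bipartition_adj(1)[OF bip au] aA by blast
  then have uV: "u \<in> verts G" using AB by blast
  \<comment> \<open>Two leaves \<open>u\<close> and \<open>l\<close> joined through \<open>a\<close>
    would make up the whole tree with \<open>a\<close>.\<close>
  have unl: "\<not> leaf G u"
  proof
    assume lu: "leaf G u"
    have "verts G \<subseteq> {u, a, l}"
      by (rule connected_closed_set[OF con _ uV])
        (use leafD[OF lu adj_sym[OF au]] leafD[OF lf adj_sym[OF al]] u(2) in auto)
    then show False using small[of u a l] ord b by simp
  qed
  \<comment> \<open>From here on depths are measured from \<open>u\<close>.\<close>
  obtain p' d' where rt': "rooted G u p' d'" using tree_rooted[OF tree uV] by blast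
  have d'u: "d' u = 0" using rt' by (simp add: rooted_def)
  have pv': "p' v \<in> verts G" "adj G v (p' v)" "d' v = Suc (d' (p' v))"
    if "v \<in> verts G" "v \<noteq> u" for v
    using rt' that by (auto simp: rooted_def)
  show ?thesis
  proof (cases "\<exists>x\<in>A. \<not> adj G x u")
    case True
    then obtain x where x: "x \<in> A" "\<not> adj G x u" by blast
    then have xV: "x \<in> verts G" "x \<noteq> u" using AB uB by auto
    have xp: "p' x \<noteq> u" using pv'(2)[OF xV] x(2) by metis
    \<comment> \<open>Depth 1 is excluded since \<open>x\<close> is not adjacent to
      \<open>u\<close>, and parity then lifts the bound 2 to 3.\<close>
    have "odd (d' x)"
      using rooted_bipartition_parity[OF sg bip rt' uB xV(1)] x(1) AB by auto
    moreover have "2 \<le> d' x" using pv'(3)[OF xV] pv'(3)[OF pv'(1)[OF xV] xp] by simp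
    ultimately have dx: "3 \<le> d' x" by (cases "d' x = 2") auto
    obtain v where v: "v \<in> verts G" "\<And>w. w \<in> verts G \<Longrightarrow> d' w \<le> d' v"
      using ex_deepest[OF sg \<open>verts G \<noteq> {}\<close>] by blast
    have lv: "leaf G v" by (rule deepest_leaf[OF sg rt' v(2)])
    then have vB: "v \<in> B" using nlA v(1) AB by blast
    have "3 \<le> d' v" using dx v(2)[OF xV(1)] by simp
    \<comment> \<open>Neighbours of \<open>u\<close> have depth 1, so their neighbours have depth at
      most 2.\<close>
    then have "\<not> adj G k v" if "adj G u k" for k
      using rooted_depth_adj[OF sg rt' that] rooted_depth_adj[OF sg rt', of k v] d'u by auto
    then show ?thesis
      using coloring_subdivision[OF sg bip two uB unl lB lf adj_sym[OF au] al vB lv] card(1) by blast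
  next
    case False
    have "\<exists>w. w \<noteq> u \<and> (\<forall>x. adj G a x \<longleftrightarrow> x = u \<or> x = w)" if "a \<in> A" for a
      using two[OF that] False that by metis
    moreover have "\<exists>a. adj G w a" if "w \<in> B - {u}" for w
      using pv'(2)[of w] that AB by blast
    ultimately show ?thesis using octopus_iso[OF sg bip card uB] not_iso by blast
  qed
qed

lemma non_octopus_coloring:
  assumes tree: "is_tree G" and ord: "order G = 2 * b + 1" and b: "2 \<le> b"
    and not_iso: "\<not> graph_iso G (octopus b)"
  shows "\<exists>c. proper_coloring G c \<and> no_rainbow_P5 G c \<and> b + 3 \<le> card (c ` verts G)"
proof -
  have sg: "simple_graph G" and con: "graph_connected G" using tree by (auto simp: is_tree_def)
  then have fin: "finite (verts G)" by (simp add: simple_graph_def)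
  obtain A B where bip: "bipartition G A B" and le: "card A \<le> card B"
    using tree_bipartition[OF tree] bipartition_swap by (metis nle_le)
  have AB: "A \<union> B = verts G" "A \<inter> B = {}" using bip by (auto simp: bipartition_def)
  have sum: "card A + card B = 2 * b + 1"
  proof -
    have "finite A" "finite B" using AB fin by (metis finite_Un)+
    then show ?thesis using ord AB card_Un_disjoint[of A B] by simp
  qed
  \<comment> \<open>If \<open>A\<close> were empty there would be no edges, and connectedness would
    leave a single vertex. A nonempty \<open>A\<close> makes the constant color occur.\<close>
  have "A \<noteq> {}"
  proof
    assume A: "A = {}"
    obtain x where x: "x \<in> verts G" using con by (auto simp: graph_connected_def)
    have "verts G \<subseteq> {x}"
      by (rule connected_closed_set[OF con _ x]) (use bip A in \<open>auto simp: bipartition_def\<close>)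
    then show False using ord b card_mono[of "{x}" "verts G"] by simp
  qed
  \<comment> \<open>The sum is odd, so \<open>b\<close> and \<open>b + 1\<close> is the only split
    with \<open>card B\<close> below \<open>b + 2\<close>.\<close>
  consider "b + 2 \<le> card B" | "card A = b" "card B = Suc b" using le sum by linarith
  then show ?thesis
  proof cases
    case 1
    then show ?thesis
      using coloring_constant_on_part[OF sg bip, of "{}"] \<open>A \<noteq> {}\<close> by fastforce
  next
    case 2
    show ?thesis
    proof (cases "\<exists>a\<in>A. leaf G a")
      case True
      then obtain a where a: "a \<in> A" "leaf G a" by blast
      \<comment> \<open>The constant color still occurs besides the leaf's own and the
        \<open>b + 1\<close> colors on \<open>B\<close>, giving \<open>b + 3\<close>.\<close>
      have "A - {a} \<noteq> {}" using 2(1) b card_mono[of "{a}" A] by auto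
      then show ?thesis
        using coloring_constant_on_part[OF sg bip, of "{a}"] a 2 by fastforce
    next
      case False
      then show ?thesis
        using non_octopus_coloring_two_neighbours[OF tree bip 2 b _ not_iso]
          part_without_leaves_two_neighbours[OF tree bip] 2 by simp
    qed
  qed
qed

theorem theorem10:
  fixes n :: nat
  assumes "odd n" and "n \<ge> 5"
  shows "is_tree (octopus ((n - 1) div 2)) \<and> order (octopus ((n - 1) div 2)) = n
    \<and> (cp5 (octopus ((n - 1) div 2)) = (n + 3) div 2
       \<and> (\<forall>T :: 'a ugraph. is_tree T \<and> order T = n \<and> cp5 T = (n + 3) div 2
            \<longrightarrow> graph_iso T (octopus ((n - 1) div 2))))
    \<and> (c5 (octopus ((n - 1) div 2)) = (n + 3) div 2
       \<and> (\<forall>T :: 'a ugraph. is_tree T \<and> order T = n \<and> c5 T = (n + 3) div 2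
            \<longrightarrow> graph_iso T (octopus ((n - 1) div 2))))"
proof -
  define b where "b = (n - 1) div 2"
  have b: "n = 2 * b + 1" "2 \<le> b" "(n + 3) div 2 = b + 2"
    using assms by (auto simp: b_def elim!: oddE)
  \<comment> \<open>Both parameters at once: a proper coloring with \<open>b + 3\<close> colors
    bounds \<open>cp5\<close> and \<open>c5\<close> from below.\<close>
  have iso: "graph_iso T (octopus b)"
    if T: "is_tree T" "order T = n" "cp5 T = b + 2 \<or> c5 T = b + 2" for T :: "'a ugraph"
  proof (rule ccontr)
    assume "\<not> ?thesis"
    then obtain c where c: "proper_coloring T c" "no_rainbow_P5 T c" "b + 3 \<le> card (c ` verts T)"
      using non_octopus_coloring[of T b] T b by auto
    moreover have "simple_graph T" using T(1) by (simp add: is_tree_def)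
    ultimately show False using cp5_ge[of T c] c5_ge[of T c] T(3) by auto
  qed
  show ?thesis
    unfolding b_def[symmetric] b(3)
    using tree_octopus order_octopus[of b] octopus_cp5_c5[of b] b(1,2) iso by simp
qed

end
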